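(* Let $m\in\mathbb{Z}$ and let $p$ be a prime dividing $x^2-mx-1$ for some integer $x$, with $\gcd(p,m^2+4)=1$. Let $T_n(m)=\left(m^{i+j-n-1}\binom{i-1}{n-j}\right)_{1\le i,j\le n}$. Then $T_n(m)^{p-1}\equiv I_n\pmod p$ for every $n\ge1$, where $I_n$ is the $n\times n$ identity matrix.
   Context: Binomial coefficients $\binom{a}{b}$ are $0$ when $b<0$ or $b>a$; the entry $m^{i+j-n-1}\binom{i-1}{n-j}$ is $0$ when the binomial coefficient vanishes, so $T_n(m)$ is an integer matrix. Congruence of matrices modulo $p$ is entrywise. *)

theory Defs
  imports "Jordan_Normal_Form.Matrix" "HOL-Number_Theory.Cong"
begin

text \<open>Matrices are indexed from 0 here, so the entry at position \<open>(i', j')\<close> is the entry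
  at row \<open>i = i' + 1\<close> and column \<open>j = j' + 1\<close> in 1-based indexing.
  Since \<open>1 \<le> i\<close> and \<open>j \<le> n\<close>, the binomial arguments do not truncate. The exponent
  \<open>i + j - n - 1\<close> truncates only if \<open>n - j > i - 1\<close>, when the binomial coefficient is \<open>0\<close>.\<close>

definition T_mat :: "nat \<Rightarrow> int \<Rightarrow> int mat" where
  "T_mat n m = mat n n (\<lambda>(i', j').
     let i = i' + 1; j = j' + 1
     in m ^ (i + j - n - 1) * int ((i - 1) choose (n - j)))"

definition mat_cong :: "int mat \<Rightarrow> int mat \<Rightarrow> int \<Rightarrow> bool" where
  "mat_cong A B q \<longleftrightarrow> dim_row A = dim_row B \<and> dim_col A = dim_col B \<and>
     (\<forall>i < dim_row A. \<forall>j < dim_col A. [A $$ (i, j) = B $$ (i, j)] (mod q))"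

end

theory Submission
  imports Defs "HOL-Number_Theory.Residues" "HOL-Computational_Algebra.Polynomial"
begin

text \<open>\<open>T_mat (N + 1) m\<close> is the matrix of the \<open>N\<close>-th symmetric power of
  \<open>(x, y) \<mapsto> (m x + y, x)\<close> on the monomials \<open>x\<^sup>i y\<^bsup>N - i\<^esup>\<close>. Hence its \<open>k\<close>-th power sends
  \<open>s\<^sub>1\<^sup>i s\<^sub>0\<^bsup>N - i\<^esup>\<close> to \<open>s\<^bsub>k + 1\<^esub>\<^sup>i s\<^sub>k\<^bsup>N - i\<^esup>\<close> for any sequence with
  \<open>s\<^bsub>k + 2\<^esub> = m s\<^bsub>k + 1\<^esub> + s\<^sub>k\<close>. Modulo \<open>p\<close> the characteristic polynomial \<open>x\<^sup>2 - m x - 1\<close> has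
  two distinct nonzero roots, so by Fermat such sequences have period \<open>p - 1\<close>. Starting from
  \<open>s\<^sub>0 = 1\<close>, \<open>s\<^sub>1 = X\<close> in \<open>\<int>[X]\<close> and comparing coefficients gives the claim.\<close>

fun lucas_seq :: "'a::comm_ring_1 \<Rightarrow> 'a \<Rightarrow> 'a \<Rightarrow> nat \<Rightarrow> 'a" where
  "lucas_seq m y x 0 = y"
| "lucas_seq m y x (Suc 0) = x"
| "lucas_seq m y x (Suc (Suc k)) = m * lucas_seq m y x (Suc k) + lucas_seq m y x k"

lemma T_mat_carrier [simp]: "T_mat n m \<in> carrier_mat n n"
  by (simp add: T_mat_def)

text \<open>Binomial theorem: choosing \<open>y\<close> from \<open>k = N - j\<close> of the
  \<open>l\<close> factors of \<open>(m x + y)^l\<close> produces the term in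
  \<open>x^j y^(N - j)\<close>.\<close>

lemma sum_T_mat_row:
  fixes x y :: "'a::comm_ring_1"
  assumes "l \<le> N"
  shows "(\<Sum>j\<le>N. of_int (T_mat (Suc N) m $$ (l, j)) * (x ^ j * y ^ (N - j))) =
    (of_int m * x + y) ^ l * x ^ (N - l)"
proof -
  let ?g = "\<lambda>k. of_int (m ^ (l - k) * int (l choose k)) * (x ^ (N - k) * y ^ k)"
  have "(\<Sum>j\<le>N. of_int (T_mat (Suc N) m $$ (l, j)) * (x ^ j * y ^ (N - j))) = (\<Sum>j\<le>N. ?g (N - j))"
  proof (rule sum.cong, goal_cases)
    case (2 j)
    \<comment> \<open>For \<open>j \<le> N\<close> the two truncated exponents agree, even when both
      collapse to 0.\<close>
    have "m ^ (l + j - N) * int (l choose (N - j)) = m ^ (l - (N - j)) * int (l choose (N - j))"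
      using 2 by (simp add: algebra_simps)
    with 2 show ?case using assms by (simp add: T_mat_def)
  qed auto
  also have "\<dots> = (\<Sum>k\<le>N. ?g k)"
    using sum.nat_diff_reindex[of ?g "Suc N"] by (simp add: lessThan_Suc_atMost)
  also have "\<dots> = (\<Sum>k\<le>l. ?g k)"
    by (rule sum.mono_neutral_right) (use assms in \<open>auto simp: not_le binomial_eq_0\<close>)
  also have "\<dots> = (\<Sum>k\<le>l. of_nat (l choose k) * y ^ k * (of_int m * x) ^ (l - k)) * x ^ (N - l)"
    unfolding sum_distrib_right
  proof (rule sum.cong, goal_cases)
    case (2 k)
    then have "N - k = (l - k) + (N - l)" using assms by simp
    then have "x ^ (N - k) = x ^ (l - k) * x ^ (N - l)" by (simp add: power_add)
    then show ?case by (simp add: power_mult_distrib)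
  qed auto
  also have "\<dots> = (y + of_int m * x) ^ l * x ^ (N - l)"
    by (subst binomial_ring) simp
  finally show ?thesis by (simp add: add.commute)
qed

text \<open>Split off the last factor of the power: by the row identity and the recurrence it moves
  the window \<open>(s (Suc a), s a)\<close> one step on. The remaining \<open>k\<close> factors
  then act at \<open>Suc a\<close>, so the induction needs \<open>a\<close> arbitrary.\<close>

lemma sum_T_mat_power_row:
  fixes s :: "nat \<Rightarrow> 'a::comm_ring_1"
  assumes rec: "\<And>k. s (Suc (Suc k)) = of_int m * s (Suc k) + s k" and "i \<le> N"
  shows "(\<Sum>j\<le>N. of_int ((T_mat (Suc N) m ^\<^sub>m k) $$ (i, j)) * (s (Suc a) ^ j * s a ^ (N - j))) =
    s (Suc (a + k)) ^ i * s (a + k) ^ (N - i)"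
proof (induction k arbitrary: a)
  case 0
  have "(\<Sum>j\<le>N. of_int ((T_mat (Suc N) m ^\<^sub>m 0) $$ (i, j)) * (s (Suc a) ^ j * s a ^ (N - j))) =
     (\<Sum>j\<le>N. if i = j then s (Suc a) ^ j * s a ^ (N - j) else 0)"
    by (rule sum.cong) (use assms in \<open>auto simp: T_mat_def\<close>)
  then show ?case using assms by simp
next
  case (Suc k)
  let ?T = "T_mat (Suc N) m"
  have P: "?T ^\<^sub>m k \<in> carrier_mat (Suc N) (Suc N)" by simp
  have ent: "(?T ^\<^sub>m Suc k) $$ (i, j) = (\<Sum>l\<le>N. (?T ^\<^sub>m k) $$ (i, l) * ?T $$ (l, j))"
    if "j \<le> N" for j
    using that assms(2) carrier_matD[OF P] carrier_matD[OF T_mat_carrier[of "Suc N" m]]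
    by (simp add: scalar_prod_def atLeast0LessThan lessThan_Suc_atMost del: sum.op_ivl_Suc)
  have "(\<Sum>j\<le>N. of_int ((?T ^\<^sub>m Suc k) $$ (i, j)) * (s (Suc a) ^ j * s a ^ (N - j))) =
    (\<Sum>j\<le>N. \<Sum>l\<le>N. of_int ((?T ^\<^sub>m k) $$ (i, l)) *
       (of_int (?T $$ (l, j)) * (s (Suc a) ^ j * s a ^ (N - j))))"
    by (rule sum.cong)
      (simp_all del: pow_mat.simps add: ent sum_distrib_right mult.assoc)
  also have "\<dots> = (\<Sum>l\<le>N. of_int ((?T ^\<^sub>m k) $$ (i, l)) *
       (\<Sum>j\<le>N. of_int (?T $$ (l, j)) * (s (Suc a) ^ j * s a ^ (N - j))))"
    by (subst sum.swap) (simp add: sum_distrib_left)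
  also have "\<dots> = (\<Sum>l\<le>N. of_int ((?T ^\<^sub>m k) $$ (i, l)) *
       (s (Suc (Suc a)) ^ l * s (Suc a) ^ (N - l)))"
    by (rule sum.cong) (simp_all add: sum_T_mat_row rec)
  also have "\<dots> = s (Suc (Suc a + k)) ^ i * s (Suc a + k) ^ (N - i)"
    by (rule Suc.IH)
  finally show ?case by simp
qed

lemma fermat_theorem_int:
  fixes a :: int
  assumes "prime p" "\<not> int p dvd a"
  shows "[a ^ (p - 1) = 1] (mod int p)"
proof -
  have p: "int p > 0" using assms(1) prime_gt_0_nat by simp
  define b where "b = nat (a mod int p)"
  have b: "int b = a mod int p" using p by (simp add: b_def)
  have "\<not> int p dvd int b" using assms(2) by (simp add: b dvd_mod_iff)
  then have "\<not> p dvd b" by simp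
  then have "[b ^ (p - 1) = 1] (mod p)" by (rule fermat_theorem[OF assms(1)])
  then have "[int b ^ (p - 1) = 1] (mod int p)"
    using cong_int_iff[of "b ^ (p - 1)" 1 p] by simp
  moreover have "[a ^ (p - 1) = int b ^ (p - 1)] (mod int p)"
    by (rule cong_pow) (simp add: b cong_def)
  ultimately show ?thesis using cong_trans by blast
qed

text \<open>The roots of the characteristic polynomial sum to \<open>m\<close>, so
  \<open>m - r\<close> is the other root modulo \<open>q\<close>. Removing its component leaves a
  geometric sequence of ratio \<open>r\<close>.\<close>

lemma recurrence_root_cong:
  fixes s :: "nat \<Rightarrow> int"
  assumes rec: "\<And>k. s (Suc (Suc k)) = m * s (Suc k) + s k"
    and root: "q dvd r ^ 2 - m * r - 1"
  shows "[s (Suc k) - (m - r) * s k = r ^ k * (s 1 - (m - r) * s 0)] (mod q)"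
proof (induction k)
  case (Suc k)
  have "s (Suc (Suc k)) - (m - r) * s (Suc k) - r * (s (Suc k) - (m - r) * s k) =
      - ((r ^ 2 - m * r - 1) * s k)"
    by (simp add: rec algebra_simps power2_eq_square)
  with root have "[s (Suc (Suc k)) - (m - r) * s (Suc k) = r * (s (Suc k) - (m - r) * s k)] (mod q)"
    by (simp add: cong_iff_dvd_diff)
  also have "[r * (s (Suc k) - (m - r) * s k) = r * (r ^ k * (s 1 - (m - r) * s 0))] (mod q)"
    by (intro cong_mult cong_refl Suc.IH)
  finally show ?case by (simp add: mult.assoc)
qed simp

text \<open>By Fermat each root gives one linear congruence for the pair \<open>s p\<close>,
  \<open>s (p - 1)\<close>. The two together determine the pair, because the difference of the roots
  is invertible modulo \<open>p\<close>.\<close>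

lemma recurrence_periodic_mod_prime:
  fixes s :: "nat \<Rightarrow> int"
  assumes rec: "\<And>k. s (Suc (Suc k)) = m * s (Suc k) + s k"
    and p: "prime p" and root: "int p dvd r ^ 2 - m * r - 1"
    and cop: "coprime (int p) (m ^ 2 + 4)"
  shows "[s (p - 1) = s 0] (mod int p)" and "[s p = s 1] (mod int p)"
proof -
  have key: "[s p - (m - t) * s (p - 1) = s 1 - (m - t) * s 0] (mod int p)"
    if t: "int p dvd t ^ 2 - m * t - 1" for t
  proof -
    \<comment> \<open>A root satisfies \<open>t * (t - m) = 1\<close> modulo \<open>p\<close>, so it
      is a unit and Fermat applies.\<close>
    have "\<not> int p dvd t"
    proof
      assume "int p dvd t"
      then have "int p dvd t * (t - m) - (t ^ 2 - m * t - 1)"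
        by (rule dvd_diff[OF dvd_mult2 t])
      also have "t * (t - m) - (t ^ 2 - m * t - 1) = 1"
        by (simp add: algebra_simps power2_eq_square)
      finally show False using p by (auto simp: prime_nat_iff)
    qed
    then have "[t ^ (p - 1) * (s 1 - (m - t) * s 0) = 1 * (s 1 - (m - t) * s 0)] (mod int p)"
      by (intro cong_mult cong_refl fermat_theorem_int p)
    moreover have "[s (Suc (p - 1)) - (m - t) * s (p - 1) =
        t ^ (p - 1) * (s 1 - (m - t) * s 0)] (mod int p)"
      by (rule recurrence_root_cong[where s = s and m = m, OF rec t])
    ultimately show ?thesis
      using cong_trans prime_gt_0_nat[OF p] by fastforce
  qed
  have "(m - r) ^ 2 - m * (m - r) - 1 = r ^ 2 - m * r - 1"
    by (simp add: algebra_simps power2_eq_square)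
  with root have k2: "[s p - r * s (p - 1) = s 1 - r * s 0] (mod int p)"
    using key[of "m - r"] by simp
  note k1 = key[OF root]
  \<comment> \<open>\<open>2 * r - m\<close> is the difference of the roots \<open>r\<close> and
    \<open>m - r\<close>; its square is the discriminant \<open>m ^ 2 + 4\<close> modulo
    \<open>p\<close>.\<close>
  have "m ^ 2 + 4 = (2 * r - m) * (2 * r - m) - 4 * (r ^ 2 - m * r - 1)"
    by (simp add: algebra_simps power2_eq_square)
  then have "int p dvd m ^ 2 + 4" if "int p dvd 2 * r - m"
    using that root by (metis dvd_diff dvd_mult)
  moreover have "\<not> int p dvd m ^ 2 + 4"
    using cop p by (metis coprime_absorb_left not_prime_unit prime_nat_int_transfer)
  ultimately have "coprime (2 * r - m) (int p)"
    using p by (metis coprime_commute prime_imp_coprime prime_nat_int_transfer)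
  moreover have "[(2 * r - m) * s (p - 1) = (2 * r - m) * s 0] (mod int p)"
    using cong_diff[OF k1 k2] by (simp add: algebra_simps)
  ultimately show *: "[s (p - 1) = s 0] (mod int p)"
    by (simp add: cong_mult_lcancel)
  from cong_add[OF k2 cong_scalar_left[OF *, of r]] show "[s p = s 1] (mod int p)" by simp
qed

lemma dvd_power_diff:
  fixes x y d :: "'a::comm_ring_1"
  assumes "d dvd x - y"
  shows "d dvd x ^ n - y ^ n"
  using assms by (auto simp: power_diff_sumr2)

theorem theorem5p4:
  fixes m :: int and p :: nat
  assumes "prime p"
    and "\<exists>x :: int. int p dvd x ^ 2 - m * x - 1"
    and "gcd (int p) (m ^ 2 + 4) = 1"
  shows "\<forall>n \<ge> 1. mat_cong (T_mat n m ^\<^sub>m (p - 1)) (1\<^sub>m n) (int p)"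
proof (intro allI impI)
  fix n :: nat assume "n \<ge> 1"
  then obtain N where n: "n = Suc N" by (cases n) auto
  obtain r where r: "int p dvd r ^ 2 - m * r - 1" using assms(2) by blast
  \<comment> \<open>Now \<open>s 1 ^ j * s 0 ^ (N - j)\<close> is \<open>X^j\<close>, so a whole row
    of the matrix power is stored as the coefficients of one polynomial.\<close>
  define s :: "nat \<Rightarrow> int poly" where "s = lucas_seq (of_int m) 1 [:0, 1:]"
  have rec: "s (Suc (Suc k)) = of_int m * s (Suc k) + s k" for k by (simp add: s_def)
  have coeff_rec: "coeff (s (Suc (Suc k))) l = m * coeff (s (Suc k)) l + coeff (s k) l" for k l
    by (simp add: rec of_int_poly)
  have cop: "coprime (int p) (m ^ 2 + 4)" using assms(3) by (simp add: coprime_iff_gcd_eq_1)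
  \<comment> \<open>Since \<open>m\<close> is a constant, each coefficient obeys the integer
    recurrence on its own, and periodicity lifts to polynomials.\<close>
  note per = recurrence_periodic_mod_prime[where s = "\<lambda>k. coeff (s k) l" and m = m for l,
      OF coeff_rec assms(1) r cop]
  have s0: "[:int p:] dvd s (p - 1) - s 0" and s1: "[:int p:] dvd s p - s 1"
    using per by (simp_all add: const_poly_dvd_iff cong_iff_dvd_diff)
  let ?P = "T_mat n m ^\<^sub>m (p - 1)"
  have "[?P $$ (i, j) = 1\<^sub>m n $$ (i, j)] (mod int p)" if ij: "i < n" "j < n" for i j
  proof -
    have "(\<Sum>j\<le>N. of_int (?P $$ (i, j)) * (s (Suc 0) ^ j * s 0 ^ (N - j))) =
        s (Suc (0 + (p - 1))) ^ i * s (0 + (p - 1)) ^ (N - i)"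
      unfolding n by (rule sum_T_mat_power_row) (use rec ij n in auto)
    then have "(\<Sum>j\<le>N. monom (?P $$ (i, j)) j) = s p ^ i * s (p - 1) ^ (N - i)"
      using prime_gt_0_nat[OF assms(1)]
      by (simp add: s_def of_int_poly monom_altdef)
    moreover have "[:int p:] dvd s p ^ i * s (p - 1) ^ (N - i) - s 1 ^ i * s 0 ^ (N - i)"
    proof -
      have "s p ^ i * s (p - 1) ^ (N - i) - s 1 ^ i * s 0 ^ (N - i) =
          (s p ^ i - s 1 ^ i) * s (p - 1) ^ (N - i) +
          s 1 ^ i * (s (p - 1) ^ (N - i) - s 0 ^ (N - i))"
        by (simp add: algebra_simps)
      then show ?thesis
        using dvd_power_diff[OF s0] dvd_power_diff[OF s1] by (metis dvd_add dvd_mult dvd_mult2)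
    qed
    \<comment> \<open>\<open>X^i\<close> encodes row \<open>i\<close> of the identity
      matrix.\<close>
    moreover have "s 1 ^ i * s 0 ^ (N - i) = monom 1 i"
      by (simp add: s_def monom_altdef)
    ultimately have "[:int p:] dvd (\<Sum>j\<le>N. monom (?P $$ (i, j)) j) - monom 1 i" by simp
    then have "int p dvd coeff ((\<Sum>j\<le>N. monom (?P $$ (i, j)) j) - monom 1 i) j"
      by (simp only: const_poly_dvd_iff)
    then show ?thesis
      using ij n by (simp add: coeff_sum cong_iff_dvd_diff)
  qed
  moreover have "?P \<in> carrier_mat n n" by simp
  ultimately show "mat_cong ?P (1\<^sub>m n) (int p)"
    unfolding mat_cong_def by (metis carrier_matD one_carrier_mat)
qed

end
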